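(* If $m$ and $n$ are integers with $m\geq 12$ and $n\geq 12$, then $M(m, n)\leq 9$.
   Context: The $T$-tetromino is the polyomino formed by four unit squares: three in a row together with a fourth square attached to the middle square of that row. A tiling of an $m\times n$ rectangle (of unit cells) by $T$-tetrominos and monominos is a partition of its cells into copies of the $T$-tetromino (in any rotation or reflection, aligned with the grid) and single cells (monominos). The gap number $M(m,n)$ is the least number of monominos occurring in such a tiling of the $m\times n$ rectangle. *)

theory Defs
  imports Main "HOL-Library.Disjoint_Sets"
begin

text \<open>A unit cell is represented by the integer coordinates of its lower left corner.\<close>

type_synonym cell = "int \<times> int"

definition rotate_cell :: "cell \<Rightarrow> cell" where
  "rotate_cell = (\<lambda>(x, y). (- y, x))"

definition reflect_cell :: "cell \<Rightarrow> cell" where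
  "reflect_cell = (\<lambda>(x, y). (- x, y))"

definition translate_cell :: "int \<Rightarrow> int \<Rightarrow> cell \<Rightarrow> cell" where
  "translate_cell a b = (\<lambda>(x, y). (x + a, y + b))"

definition T_shape :: "cell set" where
  "T_shape = {(-1, 0), (0, 0), (1, 0), (0, 1)}"

text \<open>Every symmetry of the grid is a reflection (or not), followed by quarter turns
  and a translation.\<close>

definition T_tetrominoes :: "cell set set" where
  "T_tetrominoes =
    {translate_cell a b ` (rotate_cell ^^ k) ` (reflect_cell ^^ j) ` T_shape | a b k j. True}"

definition monominoes :: "cell set set" where
  "monominoes = {{c} | c. True}"

definition rectangle :: "int \<Rightarrow> int \<Rightarrow> cell set" where
  "rectangle m n = {0..<m} \<times> {0..<n}"

definition is_tiling :: "int \<Rightarrow> int \<Rightarrow> cell set set \<Rightarrow> bool" where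
  "is_tiling m n P \<longleftrightarrow>
    partition_on (rectangle m n) P \<and> P \<subseteq> T_tetrominoes \<union> monominoes"

definition gap_number :: "int \<Rightarrow> int \<Rightarrow> nat" where
  "gap_number m n = (LEAST k. \<exists>P. is_tiling m n P \<and> card (P \<inter> monominoes) = k)"

text \<open>The minimum is attained, because the tiling by monominoes alone always exists.\<close>

lemma gap_number_attained:
  "\<exists>P. is_tiling m n P \<and> card (P \<inter> monominoes) = gap_number m n"
proof -
  let ?P = "(\<lambda>c. {c}) ` rectangle m n"
  have "is_tiling m n ?P"
    by (auto simp: is_tiling_def partition_on_def disjoint_def monominoes_def)
  then have "\<exists>k P. is_tiling m n P \<and> card (P \<inter> monominoes) = k"
    by blast
  then show ?thesis
    unfolding gap_number_def by (rule LeastI_ex)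
qed

end

theory Submission
  imports Defs
begin

text \<open>
  Write \<open>m = h + 4 i\<close> and \<open>n = w + 4 j\<close> with \<open>h\<close> and \<open>w\<close> in \<open>{0, 2, 13, 15}\<close>. The rectangle splits into
  an \<open>m \<times> w\<close> strip, an \<open>h \<times> 4 j\<close> strip and a \<open>4 i \<times> 4 j\<close> block; the block is tiled by pinwheels
  without gaps, the second strip costs at most 4 monominoes and, after possibly exchanging the roles
  of \<open>m\<close> and \<open>n\<close>, the first one at most 5. These bounds hold for arbitrarily long strips because
  strips of widths 2, 13 and 15 admit gapless periodic tilings (periods 4, 16 and 16), so that all
  gaps can be confined to the two ends.
  The periodic tilings and their end caps were found by a transfer-matrix search.
\<close>

section \<open>T-tetrominoes in their four orientations\<close>

text \<open>The coordinates are those of the middle cell of the bar; the constructor is the compass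
  direction in which the fourth cell points.\<close>

datatype tee = N int int | E int int | S int int | W int int

fun tee_cells :: "tee \<Rightarrow> cell list" where
  "tee_cells (N x y) = [(x - 1, y), (x, y), (x + 1, y), (x, y + 1)]"
| "tee_cells (E x y) = [(x, y - 1), (x, y), (x, y + 1), (x + 1, y)]"
| "tee_cells (S x y) = [(x - 1, y), (x, y), (x + 1, y), (x, y - 1)]"
| "tee_cells (W x y) = [(x, y - 1), (x, y), (x, y + 1), (x - 1, y)]"

abbreviation tees :: "cell set set" where
  "tees \<equiv> range (\<lambda>t. set (tee_cells t))"

text \<open>The shape is mirror symmetric, so rotations alone give all orientations: zero to three
  quarter turns point the fourth cell north, west, south and east in this order.\<close>

lemma tees_subset: "tees \<subseteq> T_tetrominoes"
proof -
  have mem: "translate_cell a b ` (rotate_cell ^^ k) ` T_shape \<in> T_tetrominoes" for a b k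
  proof -
    have "translate_cell a b ` (rotate_cell ^^ k) ` (reflect_cell ^^ 0) ` T_shape \<in> T_tetrominoes"
      unfolding T_tetrominoes_def by blast
    then show ?thesis by simp
  qed
  have "set (tee_cells t) \<in> T_tetrominoes" for t
  proof (cases t)
    case (N x y)
    then have "set (tee_cells t) = translate_cell x y ` (rotate_cell ^^ 0) ` T_shape"
      by (auto simp: T_shape_def translate_cell_def)
    then show ?thesis using mem by metis
  next
    case (W x y)
    then have "set (tee_cells t) = translate_cell x y ` (rotate_cell ^^ 1) ` T_shape"
      by (auto simp: T_shape_def translate_cell_def rotate_cell_def)
    then show ?thesis using mem by metis
  next
    case (S x y)
    then have "set (tee_cells t) = translate_cell x y ` (rotate_cell ^^ 2) ` T_shape"
      by (auto simp: T_shape_def translate_cell_def rotate_cell_def numeral_2_eq_2)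
    then show ?thesis using mem by metis
  next
    case (E x y)
    then have "set (tee_cells t) = translate_cell x y ` (rotate_cell ^^ 3) ` T_shape"
      by (auto simp: T_shape_def translate_cell_def rotate_cell_def numeral_3_eq_3)
    then show ?thesis using mem by metis
  qed
  then show ?thesis by blast
qed

section \<open>Tilings with a bounded number of gaps\<close>

text \<open>An upper bound instead of an exact count lets the gaps of pieces add up and bounds be
  weakened. As \<open>card\<close> of an infinite set is 0, the bound is meaningful for finite
  regions, such as rectangles and bands.\<close>

definition tileable :: "cell set \<Rightarrow> nat \<Rightarrow> bool" where
  "tileable R k \<longleftrightarrow>
    (\<exists>P. partition_on R P \<and> P \<subseteq> tees \<union> monominoes \<and> card (P \<inter> monominoes) \<le> k)"

lemma gap_number_le:
  assumes "tileable (rectangle m n) k"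
  shows "gap_number m n \<le> k"
proof -
  obtain P where P: "partition_on (rectangle m n) P" "P \<subseteq> tees \<union> monominoes"
      "card (P \<inter> monominoes) \<le> k"
    using assms unfolding tileable_def by blast
  then have "is_tiling m n P"
    using tees_subset unfolding is_tiling_def by blast
  then have "gap_number m n \<le> card (P \<inter> monominoes)"
    unfolding gap_number_def by (intro Least_le) blast
  then show ?thesis using P(3) by simp
qed

lemma tileable_mono: "tileable R k \<Longrightarrow> k \<le> l \<Longrightarrow> tileable R l"
  unfolding tileable_def using le_trans by blast

lemma tileable_empty: "tileable {} 0"
  unfolding tileable_def by (intro exI [of _ "{}"]) (simp add: partition_on_def)

lemma tileable_Un:
  assumes "tileable R k" and "tileable R' l" and "R \<inter> R' = {}"
  shows "tileable (R \<union> R') (k + l)"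
proof -
  obtain P where P: "partition_on R P" "P \<subseteq> tees \<union> monominoes" "card (P \<inter> monominoes) \<le> k"
    using assms(1) unfolding tileable_def by blast
  obtain Q where Q: "partition_on R' Q" "Q \<subseteq> tees \<union> monominoes" "card (Q \<inter> monominoes) \<le> l"
    using assms(2) unfolding tileable_def by blast
  have "partition_on (R \<union> R') (P \<union> Q)"
    using P(1) Q(1) assms(3) unfolding partition_on_def by (auto intro!: disjoint_union)
  moreover have "card ((P \<union> Q) \<inter> monominoes) \<le> k + l"
    using card_Un_le [of "P \<inter> monominoes" "Q \<inter> monominoes"] P(3) Q(3)
    by (simp add: Int_Un_distrib2)
  ultimately show ?thesis
    unfolding tileable_def using P(2) Q(2) by (intro exI [of _ "P \<union> Q"]) auto
qed

text \<open>An injection keeps blocks disjoint and preserves their cardinalities, so monominoes and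
  only these become monominoes, and their number stays the same.\<close>

lemma tileable_image:
  assumes "tileable R k" and "inj f"
    and tees: "\<And>t. f ` set (tee_cells t) \<in> tees"
  shows "tileable (f ` R) k"
proof -
  obtain P where P: "partition_on R P" "P \<subseteq> tees \<union> monominoes" "card (P \<inter> monominoes) \<le> k"
    using assms(1) unfolding tileable_def by blast
  let ?Q = "(`) f ` P"
  have "partition_on (f ` R) ?Q"
    using P(1) disjoint_image [OF inj_on_subset [OF \<open>inj f\<close>]] unfolding partition_on_def by auto
  moreover have "?Q \<subseteq> tees \<union> monominoes"
    using P(2) tees unfolding monominoes_def by fast
  moreover have "card (?Q \<inter> monominoes) \<le> k"
  proof -
    have "is_singleton (f ` A) \<longleftrightarrow> is_singleton A" for A
      using \<open>inj f\<close> by (simp add: is_singleton_altdef card_image inj_on_subset)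
    moreover have "monominoes = Collect is_singleton"
      by (auto simp: monominoes_def is_singleton_def)
    ultimately have "?Q \<inter> monominoes = (`) f ` (P \<inter> monominoes)"
      by auto
    moreover have "inj_on ((`) f) (P \<inter> monominoes)"
      using \<open>inj f\<close> by (simp add: inj_on_def inj_image_eq_iff)
    ultimately show ?thesis
      using P(3) by (simp add: card_image)
  qed
  ultimately show ?thesis
    unfolding tileable_def by blast
qed

definition shift :: "int \<Rightarrow> cell \<Rightarrow> cell" where
  "shift a = (\<lambda>(x, y). (x + a, y))"

lemma tileable_shift:
  assumes "tileable R k"
  shows "tileable (shift a ` R) k"
proof (rule tileable_image [OF assms])
  show "inj (shift a)"
    by (auto simp: inj_on_def shift_def)
  fix t
  have "shift a ` set (tee_cells t) = set (tee_cells
      (case t of N x y \<Rightarrow> N (x + a) y | E x y \<Rightarrow> E (x + a) y | S x y \<Rightarrow> S (x + a) y | W x y \<Rightarrow> W (x + a) y))"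
    by (cases t) (auto simp: shift_def)
  then show "shift a ` set (tee_cells t) \<in> tees" by blast
qed

text \<open>Reflection in the diagonal exchanges \<open>N\<close> with \<open>E\<close> and
  \<open>S\<close> with \<open>W\<close>. It lets gluing along one axis serve for both.\<close>

lemma tileable_swap:
  assumes "tileable R k"
  shows "tileable (prod.swap ` R) k"
proof (rule tileable_image [OF assms inj_swap])
  fix t
  have "prod.swap ` set (tee_cells t) = set (tee_cells
      (case t of N x y \<Rightarrow> E y x | E x y \<Rightarrow> N y x | S x y \<Rightarrow> W y x | W x y \<Rightarrow> S y x))"
    by (cases t) auto
  then show "prod.swap ` set (tee_cells t) \<in> tees" by blast
qed

section \<open>Verification of tilings by computation\<close>

text \<open>A tiling is verified by deleting its tetrominoes from the list of cells of the region; what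
  remains is filled with monominoes. Cells and tetrominoes are listed column by column, which keeps
  every deletion close to the head of the list and the evaluation fast.\<close>

fun take_out :: "'a \<Rightarrow> 'a list \<Rightarrow> 'a list option" where
  "take_out a [] = None"
| "take_out a (x # xs) = (if x = a then Some xs else map_option ((#) x) (take_out a xs))"

fun take_out_all :: "'a list \<Rightarrow> 'a list \<Rightarrow> 'a list option" where
  "take_out_all [] xs = Some xs"
| "take_out_all (a # as) xs =
    (case take_out a xs of None \<Rightarrow> None | Some ys \<Rightarrow> take_out_all as ys)"

fun sweep :: "tee list \<Rightarrow> cell list \<Rightarrow> cell list option" where
  "sweep [] xs = Some xs"
| "sweep (t # ts) xs =
    (case take_out_all (tee_cells t) xs of None \<Rightarrow> None | Some ys \<Rightarrow> sweep ts ys)"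

text \<open>Only the first occurrence is deleted; distinctness makes this a deletion from the
  underlying set.\<close>

lemma take_out_Some:
  assumes "take_out a xs = Some ys" and "distinct xs"
  shows "distinct ys \<and> a \<notin> set ys \<and> set xs = insert a (set ys)"
  using assms by (induction xs arbitrary: ys) (fastforce split: if_splits)+

lemma take_out_all_Some:
  assumes "take_out_all as xs = Some ys" and "distinct xs"
  shows "distinct ys \<and> set as \<inter> set ys = {} \<and> set xs = set as \<union> set ys"
  using assms
proof (induction as arbitrary: xs)
  case (Cons a as)
  then obtain zs where "take_out a xs = Some zs" "take_out_all as zs = Some ys"
    by (auto split: option.splits)
  then show ?case
    using Cons.IH take_out_Some Cons.prems(2) by fastforce
qed auto

lemma tileable_tee: "tileable (set (tee_cells t)) 0"
proof -
  \<comment> \<open>Two different cells show that the tetromino is not a singleton, hence not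
    counted as a gap.\<close>
  obtain c d cs where "tee_cells t = c # d # cs" "c \<noteq> d"
    by (cases t) auto
  then have "set (tee_cells t) \<notin> monominoes" and "set (tee_cells t) \<noteq> {}"
    by (auto simp: monominoes_def)
  then show ?thesis
    unfolding tileable_def
    by (intro exI [of _ "{set (tee_cells t)}"]) (auto simp: partition_on_def)
qed

lemma tileable_monominoes: "tileable (set xs) (length xs)"
proof -
  have "card ((\<lambda>c. {c}) ` set xs \<inter> monominoes) \<le> card ((\<lambda>c. {c}) ` set xs)"
    by (rule card_mono) auto
  also have "\<dots> \<le> length xs"
    by (meson List.finite_set card_image_le card_length le_trans)
  finally show ?thesis
    unfolding tileable_def
    by (intro exI [of _ "(\<lambda>c. {c}) ` set xs"])
      (auto simp: partition_on_def disjoint_def monominoes_def)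
qed

text \<open>Each successful deletion splits off a tetromino disjoint from what is left, so only the
  cells left at the end cost monominoes.\<close>

lemma sweep_tileable:
  assumes "sweep ts xs = Some gaps" and "distinct xs"
  shows "tileable (set xs) (length gaps)"
  using assms
proof (induction ts arbitrary: xs)
  case Nil
  then show ?case using tileable_monominoes by simp
next
  case (Cons t ts)
  then obtain ys where ys: "take_out_all (tee_cells t) xs = Some ys" "sweep ts ys = Some gaps"
    by (auto split: option.splits)
  with take_out_all_Some [OF ys(1) Cons.prems(2)] show ?case
    using tileable_Un [OF tileable_tee Cons.IH [OF ys(2)], of t] by simp
qed

section \<open>Strips with jagged ends\<close>

text \<open>The strip runs in the direction of x. Ends that depend on the row allow cuts that follow
  the tetrominoes, and pieces that interlock.\<close>

definition band :: "int \<Rightarrow> (int \<Rightarrow> int) \<Rightarrow> (int \<Rightarrow> int) \<Rightarrow> cell set" where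
  "band w p q = {(x, y). 0 \<le> y \<and> y < w \<and> p y \<le> x \<and> x < q y}"

text \<open>The number \<open>l\<close> is the length of a window of columns starting at 0; the
  first conjunct guarantees that the filtered window contains the whole band.\<close>

definition certifies ::
    "tee list \<Rightarrow> int \<Rightarrow> int \<Rightarrow> (int \<Rightarrow> int) \<Rightarrow> (int \<Rightarrow> int) \<Rightarrow> nat \<Rightarrow> bool" where
  "certifies ts l w p q k \<longleftrightarrow>
    list_all (\<lambda>y. 0 \<le> p y \<and> q y \<le> l) [0..w - 1] \<and>
    (case sweep ts (filter (\<lambda>(x, y). p y \<le> x \<and> x < q y) (List.product [0..l - 1] [0..w - 1])) of
      None \<Rightarrow> False | Some gaps \<Rightarrow> length gaps \<le> k)"

lemma certified:
  assumes "certifies ts l w p q k"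
  shows "tileable (band w p q) k"
proof -
  let ?xs = "filter (\<lambda>(x, y). p y \<le> x \<and> x < q y) (List.product [0..l - 1] [0..w - 1])"
  obtain gaps where gaps: "sweep ts ?xs = Some gaps" "length gaps \<le> k"
    using assms unfolding certifies_def by (auto split: option.splits)
  have "distinct ?xs"
    by (intro distinct_filter distinct_product) simp_all
  moreover have "set ?xs = band w p q"
  proof (intro equalityI subsetI)
    fix c assume "c \<in> band w p q"
    moreover from this have "snd c \<in> set [0..w - 1]"
      by (auto simp: band_def)
    then have "0 \<le> p (snd c) \<and> q (snd c) \<le> l"
      using assms unfolding certifies_def list_all_iff by blast
    ultimately show "c \<in> set ?xs"
      by (auto simp: band_def)
  qed (auto simp: band_def)
  ultimately show ?thesis
    using sweep_tileable [OF gaps(1)] gaps(2) tileable_mono by metis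
qed

section \<open>Explicit tilings for strips of width 13\<close>

text \<open>The jagged left boundary, row by row, along which the periodic tilings of the strips of width
  13 and 15 can be cut without splitting a tetromino.\<close>

definition seam13 :: "int \<Rightarrow> int" where
  "seam13 y = [2, 1, 0, 1, 0, 1, 0, 1, 2, 1, 2, 1, 2] ! nat y"

definition seam15 :: "int \<Rightarrow> int" where
  "seam15 y = [0, 1, 2, 1, 2, 1, 0, 1, 0, 1, 1, 1, 1, 1, 2] ! nat y"

text \<open>The region lies between the seam and its translate by 16, so its translates by multiples
  of 16 fit together. The window 18 is 16 plus the largest seam entry.\<close>

lemma period13: "tileable (band 13 seam13 (\<lambda>y. 16 + seam13 y)) 0"
  by (rule certified [of "
    [W 1 2, N 1 4, N 1 6, S 2 9, W 2 11, N 3 0, E 2 2, W 3 5, N 3 7, S 4 3, E 3 11, S 5 1, E 4 5,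
     E 4 9, S 5 12, N 6 2, N 6 4, E 5 7, W 6 10, N 7 0, S 7 6, S 7 8, W 8 3, E 7 10, S 8 12,
     W 9 1, S 9 5, S 9 7, W 9 9, N 10 3, N 10 11, E 10 1, W 11 6, E 10 9, N 12 0, N 12 2, N 12 4,
     S 12 8, S 12 10, S 12 12, S 13 6, S 14 1, W 14 3, N 14 7, N 14 9, N 14 11, N 15 5, N 16 0,
     E 15 3, S 16 8, S 16 10, S 16 12]" "18"]) code_simp

text \<open>The straight right end is at column 11. The area 13 * 11 - 14 = 129 is 1 modulo 4, so
  one gap is the least possible.\<close>

lemma right_cap13: "tileable (band 13 seam13 (\<lambda>_. 11)) 1"
  by (rule certified [of "
    [N 1 2, N 1 4, N 1 6, S 2 1, S 2 9, W 2 11, W 3 3, N 3 5, N 3 7, N 4 0, E 3 11, E 4 3, W 5 6,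
     E 4 9, S 5 12, S 6 1, N 6 2, N 6 4, S 6 8, W 6 10, W 7 6, N 8 0, W 8 3, N 8 9, E 7 11,
     E 8 6, S 9 8, S 9 12, W 10 1, E 9 3, W 10 5, W 10 10]" "11"]) code_simp

text \<open>The suffix is the offset of the seam. With the right cap of 11 columns, offsets 2, 6,
  10, 14 give lengths 13, 17, 21, 25 plus multiples of 16: all lengths 1 modulo 4 from 13 on, with 4
  + 1 gaps.\<close>

lemma left_cap13_2: "tileable (band 13 (\<lambda>_. 0) (\<lambda>y. 2 + seam13 y)) 4"
  by (rule certified [of "
    [E 0 1, S 1 3, N 1 5, E 0 7, E 0 11, N 2 0, S 2 8, S 2 10, S 2 12]" "4"]) code_simp

lemma left_cap13_6: "tileable (band 13 (\<lambda>_. 0) (\<lambda>y. 6 + seam13 y)) 4"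
  by (rule certified [of "
    [E 0 1, W 1 3, E 0 5, N 1 7, E 0 10, S 1 12, N 2 0, S 2 6, W 2 9, S 3 3, N 3 4, W 3 11,
     W 4 1, S 4 7, S 4 9, N 5 5, E 4 11, N 6 0, E 5 3, S 6 8, S 6 10, S 6 12]" "8"]) code_simp

lemma left_cap13_10: "tileable (band 13 (\<lambda>_. 0) (\<lambda>y. 10 + seam13 y)) 4"
  by (rule certified [of "
    [E 0 1, S 1 3, E 0 5, W 1 7, E 0 10, S 1 12, N 2 0, N 2 4, W 2 9, N 3 2, S 3 6, N 3 7,
     W 3 11, S 4 1, S 4 9, E 4 4, E 4 11, N 6 0, N 6 2, E 5 6, S 6 8, S 6 10, S 6 12, S 7 4,
     N 7 5, W 8 1, S 8 7, S 8 9, W 8 11, S 9 3, N 10 0, E 9 5, S 10 8, S 10 10, S 10 12]" "12"]) code_simp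

lemma left_cap13_14: "tileable (band 13 (\<lambda>_. 0) (\<lambda>y. 14 + seam13 y)) 4"
  by (rule certified [of "
    [N 1 0, E 0 2, W 1 4, E 0 6, W 1 8, E 0 10, S 1 12, S 3 1, N 3 2, E 2 4, N 3 6, E 2 8,
     S 3 10, N 3 11, S 4 5, N 5 0, W 5 3, S 5 7, W 5 9, S 5 12, W 7 1, E 6 3, S 7 5, N 7 6,
     E 6 9, W 7 11, W 8 8, E 8 1, S 9 3, N 9 4, E 8 11, N 10 0, S 10 6, E 9 8, S 10 10, S 10 12,
     W 11 2, N 11 7, W 12 5, S 12 9, W 12 11, E 12 1, S 13 3, N 14 0, E 13 5, S 14 8, S 14 10,
     S 14 12]" "16"]) code_simp

text \<open>Offsets 5, 9, 13, 17 give the multiples of 4 from 16 on, with 3 + 1 gaps.\<close>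

lemma left_cap13_5: "tileable (band 13 (\<lambda>_. 0) (\<lambda>y. 5 + seam13 y)) 3"
  by (rule certified [of "
    [E 0 1, W 1 3, E 0 5, S 1 7, N 1 8, E 0 10, S 1 12, N 2 0, W 3 2, E 2 4, N 3 9, N 3 11,
     N 4 5, E 3 7, N 5 0, E 4 3, S 5 8, S 5 10, S 5 12]" "7"]) code_simp

lemma left_cap13_9: "tileable (band 13 (\<lambda>_. 0) (\<lambda>y. 9 + seam13 y)) 3"
  by (rule certified [of "
    [E 0 1, S 1 3, N 1 4, E 0 6, W 1 8, E 0 10, S 1 12, N 2 0, N 3 2, S 3 5, N 3 6, E 2 8,
     S 3 10, N 3 11, S 4 1, S 5 3, E 4 8, S 5 12, N 6 0, N 6 4, E 5 6, W 6 9, W 7 2, S 7 7,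
     N 7 11, N 8 5, E 7 9, N 9 0, E 8 3, S 9 8, S 9 10, S 9 12]" "11"]) code_simp

lemma left_cap13_13: "tileable (band 13 (\<lambda>_. 0) (\<lambda>y. 13 + seam13 y)) 3"
  by (rule certified [of "
    [E 0 1, S 1 3, N 1 4, E 0 6, S 1 8, N 1 9, E 0 11, S 2 12, E 2 1, E 2 6, W 3 10, N 4 0,
     N 4 2, E 3 4, W 4 7, S 5 5, E 4 10, S 5 12, W 6 1, N 6 3, E 5 7, W 6 9, W 7 6, N 7 11,
     E 7 1, S 8 4, E 7 9, N 9 0, N 9 2, E 8 6, S 9 8, S 9 10, S 9 12, W 10 5, S 11 1, W 11 3,
     S 11 7, S 11 9, W 11 11, N 12 5, N 13 0, E 12 3, S 13 8, S 13 10, S 13 12]" "15"]) code_simp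

lemma left_cap13_17: "tileable (band 13 (\<lambda>_. 0) (\<lambda>y. 17 + seam13 y)) 3"
  by (rule certified [of "
    [E 0 1, S 1 3, N 1 4, E 0 6, W 1 8, E 0 10, S 1 12, N 2 0, N 3 2, S 3 5, W 3 7, E 2 9,
     W 3 11, S 4 1, S 5 3, N 5 4, E 4 7, E 4 10, S 5 12, S 6 6, S 6 8, N 6 9, E 6 1, W 7 11,
     N 8 0, N 8 2, E 7 4, W 8 7, S 9 5, E 8 10, S 9 12, W 10 1, N 10 3, E 9 7, W 10 9, W 11 6,
     N 11 11, E 11 1, S 12 4, E 11 9, N 13 0, N 13 2, E 12 6, S 13 8, S 13 10, S 13 12, W 14 5,
     S 15 1, W 15 3, S 15 7, S 15 9, W 15 11, N 16 5, N 17 0, E 16 3, S 17 8, S 17 10, S 17 12]" "19"]) code_simp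

text \<open>Offsets 16, 20, 24, 28 give the lengths 3 modulo 4 from 27 on, with 2 + 1 gaps.\<close>

lemma left_cap13_16: "tileable (band 13 (\<lambda>_. 0) (\<lambda>y. 16 + seam13 y)) 2"
  by (rule certified [of "
    [E 0 1, E 0 4, S 1 6, N 1 7, E 0 10, S 1 12, S 2 2, N 2 3, W 2 9, N 3 0, S 3 5, W 3 11,
     E 3 7, S 4 9, W 5 1, E 4 3, W 5 6, E 4 11, W 6 4, S 6 8, S 6 10, S 6 12, E 6 1, N 7 6,
     N 8 0, N 8 2, E 7 4, S 8 9, W 8 11, S 9 5, W 9 7, S 10 1, S 10 3, E 9 11, N 11 4, N 11 6,
     E 10 8, S 11 10, S 11 12, N 12 0, N 12 2, W 13 5, E 12 8, W 13 11, S 14 1, W 14 3, S 14 7,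
     S 14 9, N 15 5, E 14 11, N 16 0, E 15 3, S 16 8, S 16 10, S 16 12]" "18"]) code_simp

lemma left_cap13_20: "tileable (band 13 (\<lambda>_. 0) (\<lambda>y. 20 + seam13 y)) 2"
  by (rule certified [of "
    [E 0 1, W 1 3, E 0 5, W 1 8, E 0 10, S 1 12, N 2 0, W 2 6, E 2 3, E 2 9, N 3 11, S 4 1,
     N 4 2, N 4 4, E 3 6, S 4 8, S 4 10, S 5 12, N 6 0, W 6 3, E 5 6, W 6 9, N 7 5, N 7 7,
     W 7 11, W 8 1, E 7 3, S 8 9, W 9 4, N 9 6, E 8 11, E 9 1, S 10 8, S 10 10, S 10 12, N 11 0,
     N 11 2, E 10 4, E 11 6, S 12 9, W 12 11, W 13 1, E 12 4, W 13 7, N 14 3, N 14 5, E 13 11,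
     E 14 1, S 15 7, E 14 9, S 15 12, N 16 0, N 16 2, N 16 4, N 16 8, N 16 10, W 17 6, S 18 1,
     W 18 3, N 18 9, N 18 11, N 19 5, E 18 7, N 20 0, E 19 3, S 20 8, S 20 10, S 20 12]" "22"]) code_simp

lemma left_cap13_24: "tileable (band 13 (\<lambda>_. 0) (\<lambda>y. 24 + seam13 y)) 2"
  by (rule certified [of "
    [E 0 1, S 1 3, N 1 4, E 0 6, W 1 8, E 0 10, S 1 12, N 2 0, N 3 2, W 3 5, N 3 7, E 2 9,
     W 3 11, S 4 1, W 5 3, E 4 5, S 5 8, E 4 10, S 5 12, N 6 0, W 6 6, N 6 9, E 6 3, N 7 11,
     S 8 1, N 8 2, N 8 4, E 7 6, S 8 8, S 8 10, S 9 12, N 10 0, W 10 3, E 9 6, W 10 9, N 11 5,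
     N 11 7, W 11 11, W 12 1, E 11 3, S 12 9, W 13 4, N 13 6, E 12 11, E 13 1, S 14 8, S 14 10,
     S 14 12, N 15 0, N 15 2, E 14 4, E 15 6, S 16 9, W 16 11, W 17 1, E 16 4, W 17 7, N 18 3,
     N 18 5, E 17 11, E 18 1, W 19 7, E 18 9, S 19 12, N 20 0, N 20 2, N 20 4, N 20 10, W 21 6,
     E 20 8, S 22 1, W 22 3, N 22 9, N 22 11, N 23 5, E 22 7, N 24 0, E 23 3, S 24 8, S 24 10,
     S 24 12]" "26"]) code_simp

lemma left_cap13_28: "tileable (band 13 (\<lambda>_. 0) (\<lambda>y. 28 + seam13 y)) 2"
  by (rule certified [of "
    [E 0 1, S 1 3, N 1 4, E 0 6, W 1 8, E 0 10, S 1 12, N 2 0, N 3 2, W 3 5, N 3 7, E 2 9,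
     W 3 11, S 4 1, W 5 3, E 4 5, S 5 8, E 4 10, S 5 12, N 6 0, W 6 6, N 6 9, E 6 3, N 7 11,
     S 8 1, N 8 2, N 8 4, E 7 6, S 8 8, S 8 10, S 9 12, N 10 0, W 10 3, E 9 6, W 10 9, N 11 5,
     N 11 7, W 11 11, S 12 1, E 11 3, S 12 9, N 13 2, N 13 4, N 13 6, E 12 11, N 14 0, S 14 8,
     S 14 10, S 14 12, W 15 3, N 15 5, S 16 1, S 16 7, S 16 9, W 16 11, E 16 3, N 18 0, N 18 2,
     E 17 5, W 18 8, E 17 11, S 19 4, W 19 6, S 19 10, S 19 12, W 20 1, N 20 8, N 21 3, E 20 6,
     W 21 11, E 21 1, S 22 5, S 22 7, S 22 9, N 23 0, N 23 2, E 22 11, S 24 4, S 24 6, S 24 8,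
     S 24 10, S 24 12, W 25 1, W 26 5, N 26 7, N 26 9, N 26 11, E 26 1, S 27 3, N 28 0, E 27 5,
     S 28 8, S 28 10, S 28 12]" "30"]) code_simp

text \<open>Lengths 4, 8, 12 lie below 16, the shortest multiple of 4 that the caps reach.\<close>

lemma short_strip13_4: "tileable (band 13 (\<lambda>_. 0) (\<lambda>_. 4)) 4"
  by (rule certified [of "
    [N 1 0, E 0 2, W 1 4, E 0 6, W 1 8, E 0 10, S 1 12, W 3 2, E 2 4, W 3 6, E 2 8, W 3 10]" "4"]) code_simp

lemma short_strip13_8: "tileable (band 13 (\<lambda>_. 0) (\<lambda>_. 8)) 4"
  by (rule certified [of "
    [E 0 1, W 1 3, E 0 5, S 1 7, N 1 8, E 0 10, S 1 12, N 2 0, W 3 2, E 2 4, N 3 6, E 2 10,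
     S 4 5, S 4 8, N 4 9, N 4 11, E 4 1, S 5 3, N 6 0, N 6 4, N 6 6, S 6 10, S 6 12, W 7 2,
     W 7 8]" "8"]) code_simp

lemma short_strip13_12: "tileable (band 13 (\<lambda>_. 0) (\<lambda>_. 12)) 4"
  by (rule certified [of "
    [N 1 0, E 0 2, W 1 4, E 0 6, S 1 8, E 0 10, S 1 12, N 2 9, S 3 1, N 3 2, E 2 4, S 3 6, N 3 7,
     N 3 11, S 4 10, N 5 0, W 5 3, N 5 5, W 5 8, S 5 12, W 7 1, E 6 3, E 6 7, N 7 9, N 7 11,
     E 7 5, S 8 8, E 8 1, S 9 3, N 9 4, N 9 6, S 9 10, S 9 12, N 10 0, W 11 2, W 11 5, E 10 8,
     W 11 11]" "12"]) code_simp

text \<open>Lengths 15, 19, 23 lie below 27, where the caps for 3 modulo 4 begin.\<close>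

lemma short_strip13_15: "tileable (band 13 (\<lambda>_. 0) (\<lambda>_. 15)) 3"
  by (rule certified [of "
    [N 1 0, E 0 2, W 1 4, E 0 6, W 1 8, E 0 10, S 1 12, S 3 1, N 3 2, E 2 4, W 3 6, E 2 8,
     S 3 10, N 3 11, N 5 0, S 5 3, N 5 4, E 4 6, S 5 8, N 5 9, S 5 12, S 7 1, N 7 2, S 7 5,
     N 7 6, S 7 10, N 7 11, W 8 8, N 9 0, S 9 3, N 9 4, S 9 12, W 10 6, E 9 8, W 10 10, S 11 1,
     N 11 2, W 12 4, E 11 6, W 12 8, E 11 10, S 12 12, N 13 0, W 14 2, E 13 4, W 14 6, E 13 8,
     W 14 10]" "15"]) code_simp

lemma short_strip13_19: "tileable (band 13 (\<lambda>_. 0) (\<lambda>_. 19)) 3"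
  by (rule certified [of "
    [N 1 0, E 0 2, W 1 4, E 0 6, W 1 8, E 0 10, S 1 12, S 3 1, N 3 2, E 2 4, W 3 6, E 2 8,
     S 3 10, N 3 11, N 5 0, S 5 3, N 5 4, E 4 6, S 5 8, N 5 9, S 5 12, S 7 1, N 7 2, S 7 6,
     N 7 7, S 7 10, N 7 11, W 8 4, N 9 0, S 9 8, N 9 9, S 9 12, W 10 2, E 9 4, N 10 6, S 11 5,
     S 11 10, N 11 11, E 11 1, S 12 3, S 12 7, N 12 8, N 13 0, N 13 4, S 13 12, W 14 2, W 14 6,
     S 14 9, N 14 10, E 15 1, W 16 3, E 15 5, S 16 7, N 16 8, W 16 11, N 17 0, W 18 2, E 17 4,
     W 18 6, W 18 9, E 17 11]" "19"]) code_simp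

lemma short_strip13_23: "tileable (band 13 (\<lambda>_. 0) (\<lambda>_. 23)) 3"
  by (rule certified [of "
    [E 0 1, S 1 3, N 1 4, E 0 6, W 1 8, E 0 10, S 1 12, N 2 0, N 3 2, W 3 6, E 2 8, S 3 10,
     N 3 11, S 4 1, W 4 4, E 4 7, N 5 9, S 5 12, N 6 0, N 6 2, E 5 4, S 6 6, S 6 8, S 7 10,
     N 7 11, W 8 1, E 7 4, W 8 7, N 9 3, N 9 5, W 9 9, S 9 12, E 9 1, S 10 7, N 11 0, N 11 2,
     N 11 4, E 10 9, W 11 11, S 12 6, W 12 8, W 13 1, N 13 3, E 12 11, W 14 5, E 13 8, S 14 10,
     S 14 12, E 14 1, W 15 7, N 16 0, E 15 3, W 16 5, W 16 9, N 16 11, N 17 2, S 17 7, S 18 1,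
     S 18 4, N 18 5, E 17 9, S 18 12, S 19 8, W 19 10, N 20 0, W 20 3, S 20 6, N 21 7, E 20 10,
     S 21 12, W 22 1, E 21 3, W 22 5, W 22 9]" "23"]) code_simp

section \<open>Explicit tilings for strips of width 15\<close>

lemma period15: "tileable (band 15 seam15 (\<lambda>y. 16 + seam15 y)) 0"
  by (rule certified [of "
    [N 1 0, S 1 6, S 1 8, W 2 3, E 1 10, S 2 12, N 2 13, W 3 1, S 3 5, S 3 7, W 3 9, N 4 3,
     N 4 11, S 4 14, E 4 1, W 5 6, E 4 9, N 6 0, N 6 2, N 6 4, S 6 8, S 6 10, S 6 12, N 6 13,
     W 7 6, S 8 1, W 8 3, N 8 9, N 8 11, S 8 14, N 9 5, E 8 7, N 10 0, E 9 3, S 10 8, S 10 10,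
     S 10 12, N 10 13, W 11 2, N 11 4, N 11 6, S 12 9, W 12 11, S 12 14, N 13 0, E 12 2, W 13 5,
     N 13 7, S 14 3, E 13 11, W 14 13, S 15 1, E 14 5, E 14 9, N 16 2, N 16 4, E 15 7, W 16 10,
     E 15 12, S 16 14]" "18"]) code_simp

text \<open>The area 15 * 7 - 15 = 90 is 2 modulo 4, so two gaps are the least possible.\<close>

lemma right_cap15: "tileable (band 15 seam15 (\<lambda>_. 7)) 2"
  by (rule certified [of "
    [N 1 0, S 1 6, W 1 8, W 2 3, E 1 11, N 2 13, S 3 5, W 3 7, E 2 9, S 3 12, E 3 1, S 4 3,
     S 4 10, S 4 14, N 5 0, N 5 4, E 4 7, N 5 11, W 6 2, W 6 6, W 6 9, W 6 13]" "7"]) code_simp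

text \<open>With the right cap of 7 columns, offsets 5, 9, 13, 17 give the multiples of 4 from 12
  on, with 2 + 2 gaps.\<close>

lemma left_cap15_5: "tileable (band 15 (\<lambda>_. 0) (\<lambda>y. 5 + seam15 y)) 2"
  by (rule certified [of "
    [E 0 1, E 0 4, S 1 6, N 1 7, E 0 9, E 0 12, S 1 14, N 2 0, W 2 3, S 2 10, N 2 11, N 3 5,
     N 3 8, N 3 13, S 4 1, E 3 3, S 4 7, S 4 12, N 5 2, N 5 4, W 5 10, S 5 14]" "7"]) code_simp

lemma left_cap15_9: "tileable (band 15 (\<lambda>_. 0) (\<lambda>y. 9 + seam15 y)) 2"
  by (rule certified [of "
    [E 0 1, W 1 3, E 0 5, W 1 7, E 0 9, W 1 11, E 0 13, N 2 0, S 2 14, E 2 3, E 2 6, W 3 8,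
     E 2 10, W 3 12, S 4 1, N 4 2, N 4 4, W 5 6, E 4 8, S 5 10, E 4 12, S 5 14, N 6 0, W 6 3,
     N 6 11, N 7 5, E 6 7, W 7 9, N 7 13, S 8 1, E 7 3, S 8 12, N 9 2, N 9 4, E 8 7, W 9 10,
     S 9 14]" "11"]) code_simp

lemma left_cap15_13: "tileable (band 15 (\<lambda>_. 0) (\<lambda>y. 13 + seam15 y)) 2"
  by (rule certified [of "
    [E 0 1, S 1 3, E 0 5, E 0 8, W 1 10, E 0 12, S 1 14, N 2 0, N 2 4, W 2 7, W 3 2, E 2 10,
     S 3 12, N 3 13, W 4 5, E 3 7, W 4 9, E 4 1, W 5 3, W 5 11, S 5 14, N 6 0, N 6 5, E 5 7,
     S 6 9, E 6 3, E 6 11, W 7 13, S 8 1, N 8 2, N 8 4, E 7 7, W 8 10, S 9 6, W 9 8, E 8 13,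
     N 10 0, W 10 3, E 9 11, S 10 14, N 11 5, E 10 8, N 11 10, N 11 12, S 12 1, E 11 3, S 12 7,
     S 12 9, N 13 2, N 13 4, W 13 11, S 13 14]" "15"]) code_simp

lemma left_cap15_17: "tileable (band 15 (\<lambda>_. 0) (\<lambda>y. 17 + seam15 y)) 2"
  by (rule certified [of "
    [E 0 1, S 1 3, E 0 5, E 0 8, W 1 10, E 0 12, S 1 14, N 2 0, N 2 4, W 2 7, W 3 2, E 2 10,
     S 3 12, N 3 13, W 4 5, E 3 7, W 4 9, E 4 1, W 5 3, W 5 11, S 5 14, N 6 0, N 6 5, E 5 7,
     S 6 9, E 6 3, E 6 11, W 7 13, S 8 1, N 8 2, N 8 4, E 7 7, W 8 10, S 9 6, W 9 8, E 8 13,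
     N 10 0, W 10 3, E 9 11, S 10 14, N 11 5, N 11 7, E 10 9, W 11 12, S 12 1, E 11 3, S 12 10,
     N 13 2, N 13 4, N 13 6, N 13 8, E 12 12, S 13 14, N 14 0, W 14 11, S 15 3, S 15 5, W 15 7,
     N 15 9, W 15 13, S 16 1, N 17 2, N 17 4, E 16 7, W 17 10, E 16 12, S 17 14]" "19"]) code_simp

text \<open>Offsets 4, 8, 12, 16 give the lengths 3 modulo 4 from 11 on, with 3 + 2 gaps.\<close>

lemma left_cap15_4: "tileable (band 15 (\<lambda>_. 0) (\<lambda>y. 4 + seam15 y)) 3"
  by (rule certified [of "
    [N 1 0, E 0 2, W 1 5, E 0 7, S 1 9, N 1 10, E 0 12, S 1 14, S 2 3, S 3 1, E 2 5, S 3 7,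
     E 2 12, N 4 2, N 4 4, E 3 9, W 4 11, S 4 14]" "6"]) code_simp

lemma left_cap15_8: "tileable (band 15 (\<lambda>_. 0) (\<lambda>y. 8 + seam15 y)) 3"
  by (rule certified [of "
    [N 1 0, E 0 2, W 1 4, E 0 6, S 1 9, N 1 10, E 0 12, S 1 14, W 2 7, S 3 1, N 3 2, E 2 4,
     S 3 11, N 3 12, W 4 5, E 3 7, W 4 9, S 4 14, N 5 0, W 5 3, N 6 5, E 5 7, W 6 9, E 5 11,
     N 6 13, S 7 1, E 6 3, S 7 12, N 8 2, N 8 4, E 7 7, W 8 10, S 8 14]" "10"]) code_simp

lemma left_cap15_12: "tileable (band 15 (\<lambda>_. 0) (\<lambda>y. 12 + seam15 y)) 3"
  by (rule certified [of "
    [N 1 0, N 1 2, E 0 4, N 1 6, E 0 8, W 1 10, E 0 12, S 1 14, S 2 5, W 3 1, N 3 3, S 3 7,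
     N 3 8, E 2 10, S 3 12, N 3 13, E 4 1, E 4 5, S 5 9, N 5 10, S 5 14, N 6 0, E 5 3, S 6 6,
     N 6 7, W 6 12, W 7 2, N 7 4, E 7 9, E 7 12, S 8 14, N 9 0, E 8 2, W 9 5, E 8 7, S 9 10,
     N 9 11, S 10 3, N 10 8, N 10 13, S 11 1, E 10 5, S 11 7, S 11 12, N 12 2, N 12 4, W 12 10,
     S 12 14]" "14"]) code_simp

lemma left_cap15_16: "tileable (band 15 (\<lambda>_. 0) (\<lambda>y. 16 + seam15 y)) 3"
  by (rule certified [of "
    [N 1 0, E 0 2, E 0 5, W 1 7, E 0 9, W 1 11, E 0 13, S 2 4, S 2 14, S 3 1, N 3 2, N 3 5,
     E 2 7, E 2 10, S 3 12, S 4 8, N 4 9, N 4 13, N 5 0, S 5 3, N 5 4, N 5 6, N 5 11, S 6 10,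
     S 6 14, S 7 1, N 7 2, S 7 5, S 7 7, N 7 8, W 7 12, N 9 0, S 9 3, N 9 4, N 9 6, W 9 9,
     E 8 11, S 9 14, W 10 12, S 11 1, N 11 2, W 11 5, N 11 7, E 10 9, W 12 10, E 11 12, S 12 14,
     N 13 0, W 13 3, E 12 5, S 13 8, S 14 6, E 13 10, S 14 12, N 14 13, S 15 1, E 14 3, N 15 7,
     N 15 9, N 16 2, N 16 4, W 16 11, S 16 14]" "18"]) code_simp

lemma short_strip15_4: "tileable (band 15 (\<lambda>_. 0) (\<lambda>_. 4)) 4"
  by (rule certified [of "
    [E 0 1, W 1 4, E 0 6, W 1 8, E 0 10, S 1 12, S 1 14, N 2 0, N 2 2, W 3 4, E 2 6, W 3 8,
     E 2 10, W 3 13]" "4"]) code_simp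

lemma short_strip15_8: "tileable (band 15 (\<lambda>_. 0) (\<lambda>_. 8)) 4"
  by (rule certified [of "
    [E 0 1, W 1 3, E 0 5, W 1 7, E 0 9, W 1 11, E 0 13, N 2 0, S 2 14, E 2 3, S 3 5, E 2 7,
     W 3 9, E 2 11, S 4 1, N 4 2, N 4 6, N 4 12, W 5 4, W 5 8, E 4 10, S 5 14, N 6 0, W 6 11,
     W 7 2, E 6 4, E 6 7, W 7 9, W 7 13]" "8"]) code_simp

section \<open>Gluing caps and periods into strips of arbitrary length\<close>

lemma tileable_band_glue:
  assumes "tileable (band w p q) k" and "tileable (band w q r) l"
    and "\<And>y. 0 \<le> y \<Longrightarrow> y < w \<Longrightarrow> p y \<le> q y \<and> q y \<le> r y"
  shows "tileable (band w p r) (k + l)"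
proof -
  \<comment> \<open>The rowwise order of the three boundaries makes the two bands together exactly
    the large one.\<close>
  have "band w p r = band w p q \<union> band w q r" and "band w p q \<inter> band w q r = {}"
    using assms(3) unfolding band_def by force+
  then show ?thesis
    using tileable_Un [OF assms(1,2)] by simp
qed

lemma tileable_band_shift:
  assumes "tileable (band w p q) k"
  shows "tileable (band w (\<lambda>y. a + p y) (\<lambda>y. a + q y)) k"
proof -
  have "shift a ` band w p q = band w (\<lambda>y. a + p y) (\<lambda>y. a + q y)" (is "?L = ?R")
  proof
    show "?R \<subseteq> ?L"
    proof
      fix c assume "c \<in> ?R"
      then have "shift (- a) c \<in> band w p q" and "c = shift a (shift (- a) c)"
        by (auto simp: band_def shift_def)
      then show "c \<in> ?L" by blast
    qed
  qed (auto simp: band_def shift_def)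
  then show ?thesis
    using tileable_shift [OF assms] by metis
qed

lemma rectangle_eq_band: "rectangle m n = band n (\<lambda>_. 0) (\<lambda>_. m)"
  by (auto simp: rectangle_def band_def)

text \<open>A left cap, \<open>k\<close> copies of the period and a right cap are glued along
  translates of the same seam. As the period has no gaps, the bound does not depend on
  \<open>k\<close>.\<close>

lemma tileable_strip:
  assumes left: "tileable (band w (\<lambda>_. 0) (\<lambda>y. l + p y)) a"
    and period: "tileable (band w p (\<lambda>y. d + p y)) 0"
    and right: "tileable (band w p (\<lambda>_. r)) b"
    and bounds: "\<And>y. 0 \<le> y \<Longrightarrow> y < w \<Longrightarrow> 0 \<le> p y \<and> p y \<le> r"
    and "0 \<le> l" and "0 \<le> d"
  shows "tileable (rectangle (l + d * int k + r) w) (a + b)"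
proof -
  have "tileable (band w (\<lambda>_. 0) (\<lambda>y. l + d * int k + p y)) a"
  proof (induction k)
    case 0
    then show ?case using left by simp
  next
    case (Suc k)
    have "tileable (band w (\<lambda>_. 0) (\<lambda>y. l + d * int k + (d + p y))) (a + 0)"
      by (rule tileable_band_glue [OF Suc.IH tileable_band_shift [OF period]])
        (use bounds \<open>0 \<le> l\<close> \<open>0 \<le> d\<close> in auto)
    then show ?case by (simp add: algebra_simps)
  qed
  then show ?thesis
    unfolding rectangle_eq_band
    by (rule tileable_band_glue [OF _ tileable_band_shift [OF right]])
      (use bounds \<open>0 \<le> l\<close> \<open>0 \<le> d\<close> in auto)
qed

text \<open>The bound 11 is the right end of \<open>right_cap13\<close>. The seam is a list lookup,
  meaningful only for the thirteen rows, so these are checked one by one.\<close>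

lemma seam13_bounds:
  assumes "0 \<le> y" and "y < 13"
  shows "0 \<le> seam13 y \<and> seam13 y \<le> 11"
proof -
  have "list_all (\<lambda>y. 0 \<le> seam13 y \<and> seam13 y \<le> 11) [0..12]"
    by code_simp
  then show ?thesis
    \<comment> \<open>Keeping \<open>[0..12]\<close> folded lets membership simplify to interval
      bounds.\<close>
    using assms by (simp add: list_all_iff del: upto_rec_numeral)
qed

lemma seam15_bounds:
  assumes "0 \<le> y" and "y < 15"
  shows "0 \<le> seam15 y \<and> seam15 y \<le> 7"
proof -
  have "list_all (\<lambda>y. 0 \<le> seam15 y \<and> seam15 y \<le> 7) [0..14]"
    by code_simp
  then show ?thesis
    using assms by (simp add: list_all_iff del: upto_rec_numeral)
qed

lemmas strip13 = tileable_strip [OF _ period13 right_cap13 seam13_bounds]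
lemmas strip15 = tileable_strip [OF _ period15 right_cap15 seam15_bounds]

section \<open>Gap bounds for strips of widths 13, 15 and 2\<close>

text \<open>When \<open>j\<close> counts groups of four columns, its residue selects one of four
  left caps and \<open>k\<close> is the number of periods of length 16; \<open>c\<close> belongs to
  the shortest strip that the caps give.\<close>

lemma int_mod_4_cases:
  fixes j c :: int
  assumes "c \<le> j"
  obtains k where "j = c + 4 * int k" | k where "j = c + 4 * int k + 1"
    | k where "j = c + 4 * int k + 2" | k where "j = c + 4 * int k + 3"
proof -
  define k where "k = nat ((j - c) div 4)"
  have "j = c + 4 * int k \<or> j = c + 4 * int k + 1 \<or> j = c + 4 * int k + 2 \<or> j = c + 4 * int k + 3"
    unfolding k_def using assms by auto
  then show ?thesis using that by blast
qed

lemma rectangle_13_0: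
  fixes j :: int
  assumes "0 \<le> j"
  shows "tileable (rectangle (4 * j) 13) 4"
proof -
  \<comment> \<open>The shortest strip built from caps has length 5 + 11 = 16, that is
    \<open>j = 4\<close>.\<close>
  consider "j = 0" | "j = 1" | "j = 2" | "j = 3" | "4 \<le> j"
    using assms by linarith
  then show ?thesis
  proof cases
    case 1
    then show ?thesis
      using tileable_mono [OF tileable_empty] by (simp add: rectangle_def)
  next
    case 2
    then show ?thesis using short_strip13_4 by (simp add: rectangle_eq_band)
  next
    case 3
    then show ?thesis using short_strip13_8 by (simp add: rectangle_eq_band)
  next
    case 4
    then show ?thesis using short_strip13_12 by (simp add: rectangle_eq_band)
  next
    case 5
    then show ?thesis
    proof (cases rule: int_mod_4_cases)
      case (1 k)
      then show ?thesis using strip13 [OF left_cap13_5, of k] by (simp add: algebra_simps)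
    next
      case (2 k)
      then show ?thesis using strip13 [OF left_cap13_9, of k] by (simp add: algebra_simps)
    next
      case (3 k)
      then show ?thesis using strip13 [OF left_cap13_13, of k] by (simp add: algebra_simps)
    next
      case (4 k)
      then show ?thesis using strip13 [OF left_cap13_17, of k] by (simp add: algebra_simps)
    qed
  qed
qed

lemma rectangle_13_1:
  fixes j :: int
  assumes "3 \<le> j"
  shows "tileable (rectangle (4 * j + 1) 13) 5"
  using assms
proof (cases rule: int_mod_4_cases)
  case (1 k)
  then show ?thesis using strip13 [OF left_cap13_2, of k] by (simp add: algebra_simps)
next
  case (2 k)
  then show ?thesis using strip13 [OF left_cap13_6, of k] by (simp add: algebra_simps)
next
  case (3 k)
  then show ?thesis using strip13 [OF left_cap13_10, of k] by (simp add: algebra_simps)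
next
  case (4 k)
  then show ?thesis using strip13 [OF left_cap13_14, of k] by (simp add: algebra_simps)
qed

lemma rectangle_13_3:
  fixes j :: int
  assumes "3 \<le> j"
  shows "tileable (rectangle (4 * j + 3) 13) 3"
proof -
  \<comment> \<open>The shortest strip built from caps has length 16 + 11 = 27, that is
    \<open>j = 6\<close>.\<close>
  consider "j = 3" | "j = 4" | "j = 5" | "6 \<le> j"
    using assms by linarith
  then show ?thesis
  proof cases
    case 1
    then show ?thesis using short_strip13_15 by (simp add: rectangle_eq_band)
  next
    case 2
    then show ?thesis using short_strip13_19 by (simp add: rectangle_eq_band)
  next
    case 3
    then show ?thesis using short_strip13_23 by (simp add: rectangle_eq_band)
  next
    case 4
    then show ?thesis
    proof (cases rule: int_mod_4_cases)
      case (1 k)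
      then show ?thesis
        using strip13 [OF left_cap13_16, of k] by (simp add: algebra_simps numeral_3_eq_3)
    next
      case (2 k)
      then show ?thesis
        using strip13 [OF left_cap13_20, of k] by (simp add: algebra_simps numeral_3_eq_3)
    next
      case (3 k)
      then show ?thesis
        using strip13 [OF left_cap13_24, of k] by (simp add: algebra_simps numeral_3_eq_3)
    next
      case (4 k)
      then show ?thesis
        using strip13 [OF left_cap13_28, of k] by (simp add: algebra_simps numeral_3_eq_3)
    qed
  qed
qed

lemma rectangle_15_0:
  fixes j :: int
  assumes "0 \<le> j"
  shows "tileable (rectangle (4 * j) 15) 4"
proof -
  consider "j = 0" | "j = 1" | "j = 2" | "3 \<le> j"
    using assms by linarith
  then show ?thesis
  proof cases
    case 1
    then show ?thesis
      using tileable_mono [OF tileable_empty] by (simp add: rectangle_def)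
  next
    case 2
    then show ?thesis using short_strip15_4 by (simp add: rectangle_eq_band)
  next
    case 3
    then show ?thesis using short_strip15_8 by (simp add: rectangle_eq_band)
  next
    case 4
    then show ?thesis
    proof (cases rule: int_mod_4_cases)
      case (1 k)
      then show ?thesis using strip15 [OF left_cap15_5, of k] by (simp add: algebra_simps)
    next
      case (2 k)
      then show ?thesis using strip15 [OF left_cap15_9, of k] by (simp add: algebra_simps)
    next
      case (3 k)
      then show ?thesis using strip15 [OF left_cap15_13, of k] by (simp add: algebra_simps)
    next
      case (4 k)
      then show ?thesis using strip15 [OF left_cap15_17, of k] by (simp add: algebra_simps)
    qed
  qed
qed

lemma rectangle_15_3:
  fixes j :: int
  assumes "2 \<le> j"
  shows "tileable (rectangle (4 * j + 3) 15) 5"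
  using assms
proof (cases rule: int_mod_4_cases)
  case (1 k)
  then show ?thesis using strip15 [OF left_cap15_4, of k] by (simp add: algebra_simps)
next
  case (2 k)
  then show ?thesis using strip15 [OF left_cap15_8, of k] by (simp add: algebra_simps)
next
  case (3 k)
  then show ?thesis using strip15 [OF left_cap15_12, of k] by (simp add: algebra_simps)
next
  case (4 k)
  then show ?thesis using strip15 [OF left_cap15_16, of k] by (simp add: algebra_simps)
qed

lemma rectangle_2:
  fixes m :: int
  assumes "0 \<le> m"
  shows "tileable (rectangle m 2) 4"
proof (cases "m = 0")
  case True
  then show ?thesis
    using tileable_mono [OF tileable_empty] by (simp add: rectangle_def)
next
  case False
  \<comment> \<open>The seam is a staircase: the upper row starts one column after the lower one,
    and the left cap is the single cell \<open>(0, 1)\<close>.\<close>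
  let ?p = "\<lambda>y::int. y"
  have left: "tileable (band 2 (\<lambda>_. 0) (\<lambda>y. 0 + ?p y)) 1"
    by (rule certified [of "[]" 1]) code_simp
  have period: "tileable (band 2 ?p (\<lambda>y. 4 + ?p y)) 0"
    by (rule certified [of "[N 1 0, S 3 1]" 5]) code_simp
  \<comment> \<open>One cap for each residue of the length modulo 4; they leave 1, 3, 1 and 3
    cells.\<close>
  have right:
    "tileable (band 2 ?p (\<lambda>_. 1)) 3" "tileable (band 2 ?p (\<lambda>_. 2)) 3"
    "tileable (band 2 ?p (\<lambda>_. 3)) 3" "tileable (band 2 ?p (\<lambda>_. 4)) 3"
    by (rule certified [of "[]" 1], code_simp, rule certified [of "[]" 2], code_simp,
        rule certified [of "[N 1 0]" 3], code_simp, rule certified [of "[N 1 0]" 4], code_simp)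
  note strip = tileable_strip [OF left period]
  have "1 \<le> m"
    using False assms by simp
  then show ?thesis
  proof (cases rule: int_mod_4_cases)
    case (1 k)
    then show ?thesis using strip [OF right(1), of k] by (simp add: algebra_simps)
  next
    case (2 k)
    then show ?thesis using strip [OF right(2), of k] by (simp add: algebra_simps)
  next
    case (3 k)
    then show ?thesis using strip [OF right(3), of k] by (simp add: algebra_simps)
  next
    case (4 k)
    then show ?thesis using strip [OF right(4), of k] by (simp add: algebra_simps)
  qed
qed

section \<open>Assembling rectangles from strips and square blocks\<close>

lemma tileable_rectangle_swap:
  assumes "tileable (rectangle m n) k"
  shows "tileable (rectangle n m) k"
proof -
  have "prod.swap ` rectangle m n = rectangle n m"
    by (simp add: rectangle_def product_swap)
  then show ?thesis
    using tileable_swap [OF assms] by simp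
qed

lemma tileable_rectangle_glue:
  assumes "tileable (rectangle m n) k" and "tileable (rectangle m' n) l"
    and "0 \<le> m" and "0 \<le> m'"
  shows "tileable (rectangle (m + m') n) (k + l)"
  using assms(1) tileable_band_shift [OF assms(2) [unfolded rectangle_eq_band], of m] assms(3,4)
  unfolding rectangle_eq_band by (intro tileable_band_glue) auto

lemma rectangle_4_4: "tileable (rectangle (4 * int i) (4 * int j)) 0"
proof -
  have square: "tileable (rectangle 4 4) 0"
    unfolding rectangle_eq_band
    \<comment> \<open>The pinwheel: each bar lies along one side, and the four protruding cells form
      the central 2 by 2 square.\<close>
    by (rule certified [of "[N 1 0, E 0 2, W 3 1, S 2 3]" 4]) code_simp
  have column: "tileable (rectangle (4 * int i) 4) 0" for i
  proof (induction i)
    case 0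
    then show ?case using tileable_empty by (simp add: rectangle_def)
  next
    case (Suc i)
    then show ?case
      using tileable_rectangle_glue [OF square Suc.IH] by (simp add: algebra_simps)
  qed
  have "tileable (rectangle (4 * int j) (4 * int i)) 0"
  proof (induction j)
    case 0
    then show ?case using tileable_empty by (simp add: rectangle_def)
  next
    case (Suc j)
    then show ?case
      using tileable_rectangle_glue [OF tileable_rectangle_swap [OF column] Suc.IH]
      by (simp add: algebra_simps)
  qed
  then show ?thesis by (rule tileable_rectangle_swap)
qed

text \<open>The block is first joined to the strip of width \<open>h\<close>, giving an
  \<open>h + 4 * i\<close> by \<open>4 * j\<close> rectangle; this is then joined to the strip of
  width \<open>w\<close>. Swaps turn each joint into the gluing direction.\<close>

lemma tileable_rectangle_compose:
  fixes i j h w :: int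
  assumes "tileable (rectangle (h + 4 * i) w) a" and "tileable (rectangle (4 * j) h) b"
    and "0 \<le> i" and "0 \<le> j" and "0 \<le> h" and "0 \<le> w"
  shows "tileable (rectangle (h + 4 * i) (w + 4 * j)) (a + b)"
proof -
  have "tileable (rectangle (4 * i) (4 * j)) 0"
    using rectangle_4_4 [of "nat i" "nat j"] assms(3,4) by simp
  from tileable_rectangle_glue [OF tileable_rectangle_swap [OF assms(2)] this]
  have "tileable (rectangle (4 * j) (h + 4 * i)) b"
    using assms(3,5) tileable_rectangle_swap by simp
  from tileable_rectangle_glue [OF tileable_rectangle_swap [OF assms(1)] this]
  show ?thesis
    using assms(4,6) tileable_rectangle_swap by simp
qed

section \<open>Combining the residues of both sides modulo 4\<close>

lemma rectangle_residue:
  fixes h j :: int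
  assumes "h \<in> {0, 2, 13, 15}" and "0 \<le> j"
  shows "tileable (rectangle (4 * j) h) 4"
  using assms rectangle_13_0 rectangle_15_0 rectangle_2 [of "4 * j"]
    tileable_mono [OF tileable_empty, of 4]
  by (auto simp: rectangle_def)

lemma tileable_9:
  fixes h i w j :: int
  assumes "tileable (rectangle (h + 4 * i) w) k" and "k \<le> 5"
    and "h \<in> {0, 2, 13, 15}" and "0 \<le> i" and "0 \<le> j" and "0 \<le> w"
  shows "tileable (rectangle (h + 4 * i) (w + 4 * j)) 9"
proof (rule tileable_mono)
  have "0 \<le> h"
    using assms(3) by auto
  then show "tileable (rectangle (h + 4 * i) (w + 4 * j)) (k + 4)"
    using tileable_rectangle_compose [OF assms(1) rectangle_residue] assms(3-6) by simp
  show "k + 4 \<le> 9"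
    using assms(2) by simp
qed

text \<open>The four values of \<open>h\<close> represent the residues modulo 4, and from 12 on the
  first numbers congruent to 1 and 3 are 13 and 15, so \<open>i\<close> is nonnegative.\<close>

lemma residue_decomposition:
  fixes m :: int
  assumes "12 \<le> m"
  obtains h i where "m = h + 4 * i" and "0 \<le> i" and "h \<in> {0, 2, 13, 15}"
proof -
  have "\<exists>i\<ge>0. m = 13 + 4 * i \<or> m = 2 + 4 * i \<or> m = 15 + 4 * i \<or> m = 4 * i"
    using assms by presburger
  then obtain i where "0 \<le> i"
      "m = 13 + 4 * i \<or> m = 2 + 4 * i \<or> m = 15 + 4 * i \<or> m = 4 * i"
    by blast
  then show ?thesis
    using that [of 0 i] that [of 2 i] that [of 13 i] that [of 15 i] by auto
qed

theorem theorem6: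
  fixes m n :: int
  assumes "m \<ge> 12" and "n \<ge> 12"
  shows "gap_number m n \<le> 9"
proof -
  obtain h i where m: "m = h + 4 * i" "0 \<le> i" "h \<in> {0, 2, 13, 15}"
    using residue_decomposition [OF assms(1)] by metis
  obtain w j where n: "n = w + 4 * j" "0 \<le> j" "w \<in> {0, 2, 13, 15}"
    using residue_decomposition [OF assms(2)] by metis
  have "0 \<le> h" and "0 \<le> w"
    using m(3) n(3) by auto
  \<comment> \<open>It remains to tile one full-length strip with at most 5 gaps, either along
    \<open>m\<close> or, by \<open>compose'\<close>, along \<open>n\<close>; the other pieces cost
    at most 4.\<close>
  have compose: "tileable (rectangle m n) 9" if "tileable (rectangle m w) k" "k \<le> 5" for k
    using tileable_9 [OF that [unfolded m(1)] m(3,2) n(2) \<open>0 \<le> w\<close>] unfolding m(1) n(1) .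
  have compose': "tileable (rectangle m n) 9" if "tileable (rectangle n h) k" "k \<le> 5" for k
    using tileable_rectangle_swap [OF tileable_9 [OF that [unfolded n(1)] n(3,2) m(2) \<open>0 \<le> h\<close>]]
    unfolding m(1) n(1) .
  have "0 \<le> m" and "0 \<le> n"
    using assms by simp_all
  \<comment> \<open>An even residue gives a full-length strip of width 0 or 2. For the mixed odd
    pairs the strip of width 13 is taken along the side that is 3 modulo 4, where it has only 3
    gaps.\<close>
  consider "w = 0" | "h = 0" | "w = 2" | "h = 2" | "h = 13" "w = 13" | "h = 15" "w = 13"
    | "h = 13" "w = 15" | "h = 15" "w = 15"
    using m(3) n(3) by blast
  then have "tileable (rectangle m n) 9"
  proof cases
    case 1
    then show ?thesis
      using compose [of 0] tileable_empty by (simp add: rectangle_def)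
  next
    case 2
    then show ?thesis
      using compose' [of 0] tileable_empty by (simp add: rectangle_def)
  next
    case 3
    then show ?thesis
      using compose [of 4] rectangle_2 [OF \<open>0 \<le> m\<close>] by simp
  next
    case 4
    then show ?thesis
      using compose' [of 4] rectangle_2 [OF \<open>0 \<le> n\<close>] by simp
  next
    case 5
    then show ?thesis
      \<comment> \<open>Here 13 + 4 * i is written as 4 * (3 + i) + 1; likewise 15 + 4 * i is 4 * (3
        + i) + 3 below.\<close>
      using compose [of 5] rectangle_13_1 [of "3 + i"] m by simp
  next
    case 6
    then show ?thesis
      using compose [of 3] rectangle_13_3 [of "3 + i"] m by simp
  next
    case 7
    then show ?thesis
      using compose' [of 3] rectangle_13_3 [of "3 + j"] n by simp
  next
    case 8
    then show ?thesis
      using compose [of 5] rectangle_15_3 [of "3 + i"] m by simp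
  qed
  then show ?thesis
    by (rule gap_number_le)
qed

end
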